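(* Let $A$ be a self-adjoint operator acting on an infinite-dimensional Hilbert space $\mathcal{H}$ with dense domain $\mathrm{Dom}(A)$, and let $\mathcal{L}$ be an $n$-dimensional subspace of $\mathrm{Dom}(A)$ with a basis $\{e_1,\dots,e_n\}$ such that $\|e_j\|=1$ for all $j$. Let $\beta>0$ be a constant such that $\|\sum_{j=1}^n c_j e_j\|\ge \beta\big(\sum_{j=1}^n|c_j|^2\big)^{1/2}$ for all $(c_1,\dots,c_n)\in\mathbb{C}^n$. Define $A_0,A_1,A_2\in\mathbb{C}^{n\times n}$ by $$[A_0]_{jk}=\langle Ae_j,Ae_k\rangle,\qquad [A_1]_{jk}=\langle Ae_j,e_k\rangle,\qquad [A_2]_{jk}=\langle e_j,e_k\rangle .$$ Let $\tilde A_0,\tilde A_1,\tilde A_2$ be $n\times n$ complex matrices and $\varepsilon_0,\varepsilon_1,\varepsilon_2\ge 0$ such that $$\|A_p-\tilde A_p\|_{\mathbb{C}^n}\le \varepsilon_p,\qquad p=0,1,2 .$$ If the matrix $\tilde A_0-2\zeta\tilde A_1+\zeta^2\tilde A_2$ is singular for some $\zeta\in\mathbb{C}$, then $$\mathrm{Spec}(A)\cap[\mathrm{Re}\,\zeta-\tilde\delta,\ \mathrm{Re}\,\zeta+\tilde\delta]\neq\varnothing$$ for $$\tilde\delta=\sqrt{|\mathrm{Im}\,\zeta|^2+\beta^{-2}\big(|\zeta|^2\varepsilon_2+2|\zeta|\varepsilon_1+\varepsilon_0\big)} .$$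
   Context: The inner product $\langle\cdot,\cdot\rangle$ of $\mathcal{H}$ is linear in the first argument and conjugate-linear in the second. $\|\cdot\|_{\mathbb{C}^n}$ applied to a matrix denotes the operator norm induced by the Euclidean norm of $\mathbb{C}^n$. $\mathrm{Spec}(A)$ is the spectrum of $A$. *)

theory Defs
  imports "HOL-Analysis.Analysis"
begin

class complex_inner = real_normed_vector +
  fixes scaleC :: "complex \<Rightarrow> 'a \<Rightarrow> 'a"  (infixr "*\<^sub>C" 75)
    and cinner :: "'a \<Rightarrow> 'a \<Rightarrow> complex"
  assumes scaleC_add_right: "a *\<^sub>C (x + y) = a *\<^sub>C x + a *\<^sub>C y"
    and scaleC_add_left: "(a + b) *\<^sub>C x = a *\<^sub>C x + b *\<^sub>C x"
    and scaleC_scaleC: "a *\<^sub>C (b *\<^sub>C x) = (a * b) *\<^sub>C x"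
    and scaleC_one: "1 *\<^sub>C x = x"
    and scaleR_scaleC: "scaleR r x = complex_of_real r *\<^sub>C x"
    and cinner_add_left: "cinner (x + y) z = cinner x z + cinner y z"
    and cinner_scaleC_left: "cinner (a *\<^sub>C x) y = a * cinner x y"
    and cinner_commute: "cinner x y = cnj (cinner y x)"
    and cinner_ge_zero: "0 \<le> Re (cinner x x)"
    and cinner_eq_zero_iff: "cinner x x = 0 \<longleftrightarrow> x = 0"
    and norm_eq_sqrt_cinner: "norm x = sqrt (Re (cinner x x))"

class complex_hilbert = complex_inner + complete_space

global_interpretation complex_vector: vector_space
  "scaleC :: complex \<Rightarrow> 'a \<Rightarrow> 'a::complex_inner"
  by unfold_locales
    (simp_all add: scaleC_add_right scaleC_add_left scaleC_scaleC scaleC_one)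

(* An unbounded operator is a domain D together with a function A whose values
   outside D are irrelevant. *)

definition linear_operator_on ::
    "'a::complex_inner set \<Rightarrow> ('a \<Rightarrow> 'a) \<Rightarrow> bool" where
  "linear_operator_on D A \<longleftrightarrow> complex_vector.subspace D \<and>
     (\<forall>x\<in>D. \<forall>y\<in>D. A (x + y) = A x + A y) \<and>
     (\<forall>c. \<forall>x\<in>D. A (c *\<^sub>C x) = c *\<^sub>C A x)"

(* The graph of the adjoint; it is single-valued when D is dense. *)
definition adjoint_graph ::
    "'a::complex_inner set \<Rightarrow> ('a \<Rightarrow> 'a) \<Rightarrow> ('a \<times> 'a) set" where
  "adjoint_graph D A = {(y, z). \<forall>x\<in>D. cinner (A x) y = cinner x z}"

(* Equality of graphs is equality of operators, domains included. *)
definition self_adjoint_operator ::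
    "'a::complex_hilbert set \<Rightarrow> ('a \<Rightarrow> 'a) \<Rightarrow> bool" where
  "self_adjoint_operator D A \<longleftrightarrow>
     linear_operator_on D A \<and> closure D = UNIV \<and>
     adjoint_graph D A = {(x, A x) | x. x \<in> D}"

(* Complex homogeneity of the inverse follows from that of A on D, so real
   bounded linearity suffices. *)
definition resolvent_set ::
    "'a::complex_hilbert set \<Rightarrow> ('a \<Rightarrow> 'a) \<Rightarrow> complex set" where
  "resolvent_set D A = {z. bij_betw (\<lambda>x. A x - z *\<^sub>C x) D UNIV \<and>
     bounded_linear (inv_into D (\<lambda>x. A x - z *\<^sub>C x))}"

definition spectrum ::
    "'a::complex_hilbert set \<Rightarrow> ('a \<Rightarrow> 'a) \<Rightarrow> complex set" where
  "spectrum D A = - resolvent_set D A"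

end

theory Submission
  imports Defs
begin

text \<open>
  A null vector \<open>v\<close> of the perturbed pencil yields the trial vector \<open>u = (\<Sum>j. cnj (v $ j) *\<^sub>C e j)\<close>,
  and the real part of the quadratic form of the exact pencil at \<open>v\<close> equals
  \<open>\<parallel>(A - a) u\<parallel>\<^sup>2 - (Im \<zeta>)\<^sup>2 \<parallel>u\<parallel>\<^sup>2\<close> with \<open>a = Re \<zeta>\<close>; hence \<open>\<parallel>(A - a) u\<parallel> \<le> \<delta> \<parallel>u\<parallel>\<close>.
  If \<open>a\<close> is not in the spectrum, then the inverse \<open>T\<close> of \<open>A - a\<close> is bounded and symmetric, with norm
  \<open>m \<ge> 1 / \<delta>\<close>. No spectral theorem is required: at a nearly maximising vector
  \<open>T\<^sup>2 - m\<^sup>2 = (T - m) (T + m)\<close> almost vanishes, so \<open>T - m\<close> or \<open>T + m\<close> is not bounded below, which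
  puts \<open>a + 1 / m\<close> or \<open>a - 1 / m\<close> into the spectrum of \<open>A\<close>.
\<close>

section \<open>Inner products and bounded symmetric operators\<close>

lemma cinner_add_right: "cinner x (y + z) = cinner x y + cinner x (z::'a::complex_inner)"
  by (metis cinner_add_left cinner_commute complex_cnj_add)

lemma cinner_scaleC_right: "cinner x (c *\<^sub>C y) = cnj c * cinner x (y::'a::complex_inner)"
  by (metis cinner_commute cinner_scaleC_left complex_cnj_mult)

lemma cinner_scaleR_left: "cinner (r *\<^sub>R x) y = of_real r * cinner x (y::'a::complex_inner)"
  by (simp add: scaleR_scaleC cinner_scaleC_left)

lemma cinner_scaleR_right: "cinner x (r *\<^sub>R y) = of_real r * cinner x (y::'a::complex_inner)"
  by (simp add: scaleR_scaleC cinner_scaleC_right)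

lemma cinner_diff_left: "cinner (x - y) z = cinner x z - cinner y (z::'a::complex_inner)"
  by (metis add_diff_cancel cinner_add_left diff_add_cancel)

lemma cinner_diff_right: "cinner x (y - z) = cinner x y - cinner x (z::'a::complex_inner)"
  by (metis add_diff_cancel cinner_add_right diff_add_cancel)

lemma cinner_zero_left [simp]: "cinner 0 (x::'a::complex_inner) = 0"
  by (metis cinner_diff_left diff_self)

lemma cinner_zero_right [simp]: "cinner (x::'a::complex_inner) 0 = 0"
  by (metis cinner_diff_right diff_self)

lemma cinner_sum_left: "cinner (\<Sum>i\<in>I. f i) x = (\<Sum>i\<in>I. cinner (f i) (x::'a::complex_inner))"
  by (induction I rule: infinite_finite_induct) (simp_all add: cinner_add_left)

lemma cinner_sum_right: "cinner x (\<Sum>i\<in>I. f i) = (\<Sum>i\<in>I. cinner (x::'a::complex_inner) (f i))"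
  by (induction I rule: infinite_finite_induct) (simp_all add: cinner_add_right)

lemma Re_cinner_self: "Re (cinner x x) = (norm (x::'a::complex_inner))\<^sup>2"
  by (simp add: norm_eq_sqrt_cinner cinner_ge_zero)

lemma cinner_self: "cinner x x = of_real ((norm (x::'a::complex_inner))\<^sup>2)"
proof -
  have "Im (cinner x x) = 0"
    using cinner_commute[of x x] by (metis Reals_cnj_iff complex_is_Real_iff)
  then show ?thesis by (simp add: complex_eq_iff Re_cinner_self)
qed

text \<open>Serves twice: to expand the norm of \<open>T (T x) - m^2 x\<close>, and to complete the
  square for \<open>A u - Re \<zeta> u\<close>.\<close>

lemma norm_diff_scaleR_square:
  "(norm (x - r *\<^sub>R y))\<^sup>2 = (norm x)\<^sup>2 - 2 * r * Re (cinner x y) + r\<^sup>2 * (norm (y::'a::complex_inner))\<^sup>2"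
proof -
  have "Re (cinner y x) = Re (cinner x y)"
    using arg_cong[OF cinner_commute[of y x], of Re] by simp
  then show ?thesis
    unfolding Re_cinner_self[symmetric]
    by (simp add: cinner_diff_left cinner_diff_right cinner_scaleR_left
        cinner_scaleR_right power2_eq_square algebra_simps)
qed

text \<open>With m the norm of T, the lower bounds c for T - m and d for T + m multiply to the lower
  bound c d for T^2 - m^2. Expanding the square of that inequality bounds T by a constant strictly
  below m.\<close>

lemma symmetric_not_bounded_below:
  fixes T :: "'a::complex_inner \<Rightarrow> 'a"
  assumes bl: "bounded_linear T"
    and sym: "\<And>x y. cinner (T x) y = cinner x (T y)"
    and pos: "onorm T > 0"
    and c: "c > 0" "\<And>x. c * norm x \<le> norm (T x - onorm T *\<^sub>R x)"
    and d: "d > 0" "\<And>x. d * norm x \<le> norm (T x + onorm T *\<^sub>R x)"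
  shows False
proof -
  define m where "m = onorm T"
  interpret T: bounded_linear T by (rule bl)
  have m: "m > 0" using pos by (simp add: m_def)
  have bound: "norm (T x) \<le> m * norm x" for x
    unfolding m_def by (rule onorm[OF bl])
  have main: "(norm (T x))\<^sup>2 \<le> (m\<^sup>2 - (c * d / m)\<^sup>2) * (norm x)\<^sup>2" for x
  proof -
    \<comment> \<open>The bound for T - m is applied to the vector (T + m) x, so that the two
      factors compose to T^2 - m^2.\<close>
    have "c * (d * norm x) \<le> c * norm (T x + m *\<^sub>R x)"
      using c(1) d(2)[of x] by (simp add: m_def)
    also have "\<dots> \<le> norm (T (T x + m *\<^sub>R x) - m *\<^sub>R (T x + m *\<^sub>R x))"
      using c(2) by (simp add: m_def)
    also have "T (T x + m *\<^sub>R x) - m *\<^sub>R (T x + m *\<^sub>R x) = T (T x) - m\<^sup>2 *\<^sub>R x"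
      by (simp add: T.add T.scaleR scaleR_add_right power2_eq_square)
    finally have "(c * d * norm x)\<^sup>2 \<le> (norm (T (T x) - m\<^sup>2 *\<^sub>R x))\<^sup>2"
      using c(1) d(1) by (intro power_mono) (auto simp: mult.assoc)
    \<comment> \<open>Symmetry turns the cross term \<open>Re (cinner (T (T x)) x)\<close> into the
      squared norm of T x.\<close>
    also have "\<dots> = (norm (T (T x)))\<^sup>2 - 2 * m\<^sup>2 * (norm (T x))\<^sup>2 + m^4 * (norm x)\<^sup>2"
      by (simp add: norm_diff_scaleR_square sym[of "T x" x] Re_cinner_self flip: power_mult)
    also have "\<dots> \<le> (m * norm (T x))\<^sup>2 - 2 * m\<^sup>2 * (norm (T x))\<^sup>2 + m^4 * (norm x)\<^sup>2"
      using power_mono[OF bound[of "T x"], of 2] by simp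
    also have "\<dots> = m\<^sup>2 * (m\<^sup>2 * (norm x)\<^sup>2 - (norm (T x))\<^sup>2)"
      by (simp add: algebra_simps power2_eq_square power4_eq_xxxx)
    finally have "(c * d / m)\<^sup>2 * (norm x)\<^sup>2 \<le> m\<^sup>2 * (norm x)\<^sup>2 - (norm (T x))\<^sup>2"
      using m by (simp add: power_mult_distrib power_divide field_simps)
    then show ?thesis by (simp add: algebra_simps)
  qed
  have cdm: "(c * d / m)\<^sup>2 > 0" using c(1) d(1) m by simp
  \<comment> \<open>The truncation at 0 supplies the q \<ge> 0 that \<open>onorm_bound\<close> asks
    for, whatever the sign of the difference; both arguments of \<open>max\<close> lie below m^2,
    whence q < m.\<close>
  define q where "q = sqrt (max 0 (m\<^sup>2 - (c * d / m)\<^sup>2))"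
  have "norm (T x) \<le> q * norm x" for x
  proof -
    have "(norm (T x))\<^sup>2 \<le> max 0 (m\<^sup>2 - (c * d / m)\<^sup>2) * (norm x)\<^sup>2"
      by (rule order_trans[OF main]) (intro mult_right_mono, auto)
    then have "norm (T x) \<le> sqrt (max 0 (m\<^sup>2 - (c * d / m)\<^sup>2) * (norm x)\<^sup>2)"
      by (rule real_le_rsqrt)
    then show ?thesis by (simp add: q_def real_sqrt_mult)
  qed
  moreover have "q \<ge> 0" by (simp add: q_def)
  ultimately have "m \<le> q" unfolding m_def by (intro onorm_bound)
  moreover have "q < m"
  proof -
    have "q < sqrt (m\<^sup>2)"
      unfolding q_def using cdm m by (intro real_sqrt_less_mono) simp
    then show ?thesis using m by simp
  qed
  ultimately show False by simp
qed

section \<open>Resolvent and spectrum of a self-adjoint operator\<close>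

lemma self_adjoint_operator_symmetric:
  assumes "self_adjoint_operator D A" "x \<in> D" "y \<in> D"
  shows "cinner (A x) y = cinner x (A y)"
proof -
  have "(y, A y) \<in> adjoint_graph D A"
    using assms unfolding self_adjoint_operator_def by auto
  then show ?thesis using assms(2) by (simp add: adjoint_graph_def)
qed

lemma resolvent_set_bounded_below:
  assumes "z \<in> resolvent_set D A"
  obtains K where "K > 0" "\<And>x. x \<in> D \<Longrightarrow> norm x \<le> K * norm (A x - z *\<^sub>C x)"
proof -
  let ?f = "\<lambda>x. A x - z *\<^sub>C x"
  have bij: "bij_betw ?f D UNIV" and bl: "bounded_linear (inv_into D ?f)"
    using assms by (auto simp: resolvent_set_def)
  obtain K where K: "K > 0" "\<And>y. norm (inv_into D ?f y) \<le> norm y * K"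
    using bounded_linear.pos_bounded[OF bl] by blast
  show ?thesis
  proof
    fix x assume "x \<in> D"
    then have "inv_into D ?f (?f x) = x"
      using bij by (intro inv_into_f_f) (auto simp: bij_betw_def)
    then show "norm x \<le> K * norm (A x - z *\<^sub>C x)"
      using K(2)[of "?f x"] by (simp add: mult.commute)
  qed (rule K)
qed

text \<open>Here T inverts A - a from the right, and (A - a - 1/\<mu>) T = -(1/\<mu>) (T - \<mu>).
  So the lower bound that A - a - 1/\<mu> has on D passes to T - \<mu>.\<close>

lemma shifted_resolvent_bounded_below:
  fixes a \<mu> :: real
  assumes \<mu>: "\<mu> \<noteq> 0"
    and res: "complex_of_real (a + 1 / \<mu>) \<in> resolvent_set D A"
    and T: "\<And>x. T x \<in> D" "\<And>x. A (T x) - a *\<^sub>R T x = x"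
  obtains c where "c > 0" "\<And>x. c * norm x \<le> norm (T x - \<mu> *\<^sub>R x)"
proof -
  obtain K where K: "K > 0"
    "\<And>x. x \<in> D \<Longrightarrow> norm x \<le> K * norm (A x - complex_of_real (a + 1 / \<mu>) *\<^sub>C x)"
    using resolvent_set_bounded_below[OF res] by blast
  \<comment> \<open>The constant comes from writing \<mu> x as T x - (T - \<mu>) x and bounding T x
    by K / |\<mu>| times the norm of (T - \<mu>) x.\<close>
  define c where "c = \<bar>\<mu>\<bar> / (1 + K / \<bar>\<mu>\<bar>)"
  have denom: "1 + K / \<bar>\<mu>\<bar> > 0" using K(1) by (simp add: add_pos_nonneg)
  show ?thesis
  proof
    show "c > 0" using \<mu> denom by (simp add: c_def)
    fix x
    have "A (T x) - (a + 1 / \<mu>) *\<^sub>R T x = x - (1 / \<mu>) *\<^sub>R T x"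
      using T(2)[of x] by (simp add: scaleR_add_left algebra_simps)
    also have "\<dots> = (- 1 / \<mu>) *\<^sub>R (T x - \<mu> *\<^sub>R x)"
      using \<mu> by (simp add: scaleR_diff_right)
    finally have "norm (T x) \<le> K * norm ((- 1 / \<mu>) *\<^sub>R (T x - \<mu> *\<^sub>R x))"
      using K(2)[OF T(1), of x] by (simp only: scaleR_scaleC[symmetric])
    then have 1: "norm (T x) \<le> K / \<bar>\<mu>\<bar> * norm (T x - \<mu> *\<^sub>R x)"
      by simp
    have "\<bar>\<mu>\<bar> * norm x = norm (T x - (T x - \<mu> *\<^sub>R x))" by simp
    also have "\<dots> \<le> norm (T x) + norm (T x - \<mu> *\<^sub>R x)" by (rule norm_triangle_ineq4)
    also have "\<dots> \<le> (1 + K / \<bar>\<mu>\<bar>) * norm (T x - \<mu> *\<^sub>R x)"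
      using 1 by (simp add: algebra_simps)
    finally show "c * norm x \<le> norm (T x - \<mu> *\<^sub>R x)"
      using denom by (simp add: c_def field_simps)
  qed
qed

text \<open>If the interval missed the spectrum, then a and a + 1/m, a - 1/m would all be regular
  points, m being the norm of the inverse of A - a. The last two make T - m and T + m bounded below,
  against \<open>symmetric_not_bounded_below\<close>.\<close>

lemma approximate_eigenvalue_near_spectrum:
  fixes a \<delta> :: real
  assumes sa: "self_adjoint_operator D A"
    and u: "u \<in> D" "u \<noteq> 0"
    and le: "norm (A u - a *\<^sub>R u) \<le> \<delta> * norm u"
  shows "spectrum D A \<inter> complex_of_real ` {a - \<delta> .. a + \<delta>} \<noteq> {}"
proof (rule ccontr)
  assume "\<not> ?thesis"
  then have res: "complex_of_real t \<in> resolvent_set D A" if "\<bar>t - a\<bar> \<le> \<delta>" for t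
    using that unfolding spectrum_def by (force simp: abs_le_iff)
  \<comment> \<open>The sign of \<delta> follows from the estimate at u; it places a itself in the
    interval.\<close>
  have "0 \<le> \<delta> * norm u" using le norm_ge_zero order_trans by blast
  then have \<delta>0: "\<delta> \<ge> 0" using u(2) by (simp add: zero_le_mult_iff)
  define f where "f = (\<lambda>x. A x - complex_of_real a *\<^sub>C x)"
  define T where "T = inv_into D f"
  have f_alt: "f x = A x - a *\<^sub>R x" for x by (simp add: f_def scaleR_scaleC)
  have bij: "bij_betw f D UNIV" and bl: "bounded_linear T"
    using res[of a] \<delta>0 by (auto simp: resolvent_set_def f_def T_def)
  have TD: "T x \<in> D" for x
    using bij unfolding T_def by (intro inv_into_into) (auto simp: bij_betw_def)
  have fT: "f (T x) = x" for x
    using bij unfolding T_def by (intro f_inv_into_f) (auto simp: bij_betw_def)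
  have Tf: "T (f x) = x" if "x \<in> D" for x
    using bij that unfolding T_def by (intro inv_into_f_f) (auto simp: bij_betw_def)
  \<comment> \<open>As a is real, f is symmetric on D; its inverse inherits this by writing x = f (T
    x) and y = f (T y).\<close>
  have sym: "cinner (T x) y = cinner x (T y)" for x y
  proof -
    have "cinner (T x) (f (T y)) = cinner (f (T x)) (T y)"
      using self_adjoint_operator_symmetric[OF sa TD TD]
      by (simp add: f_alt cinner_diff_left cinner_diff_right cinner_scaleR_left cinner_scaleR_right)
    then show ?thesis by (simp add: fT)
  qed
  define m where "m = onorm T"
  \<comment> \<open>Since u = T (f u), the trial vector forces 1 \<le> m \<delta>. This excludes m =
    0 and brings both a + 1/m and a - 1/m into the interval.\<close>
  have "norm u \<le> m * norm (f u)"
    using onorm[OF bl, of "f u"] Tf[OF u(1)] by (simp add: m_def)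
  also have "\<dots> \<le> m * (\<delta> * norm u)"
    using le onorm_pos_le[OF bl] by (intro mult_left_mono) (auto simp: f_alt m_def)
  finally have m\<delta>: "1 \<le> m * \<delta>" using u(2) by (simp add: mult.assoc[symmetric])
  then have m: "m > 0"
    using onorm_pos_le[OF bl] by (cases "m = 0") (auto simp: m_def)
  have "1 / m \<le> \<delta>" using m\<delta> m by (simp add: field_simps)
  then have r: "complex_of_real (a + 1 / m) \<in> resolvent_set D A"
    "complex_of_real (a + 1 / (- m)) \<in> resolvent_set D A"
    using m by (intro res; simp)+
  obtain c where c: "c > 0" "\<And>x. c * norm x \<le> norm (T x - m *\<^sub>R x)"
    using shifted_resolvent_bounded_below[OF _ r(1) TD fT[unfolded f_alt]] m by blast
  obtain d where d: "d > 0" "\<And>x. d * norm x \<le> norm (T x - (- m) *\<^sub>R x)"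
    using shifted_resolvent_bounded_below[OF _ r(2) TD fT[unfolded f_alt]] m
    by (metis neg_equal_0_iff_equal less_irrefl)
  show False
    using symmetric_not_bounded_below[OF bl sym _ c(1) _ d(1)] m c(2) d(2)
    by (simp add: m_def)
qed

section \<open>Gram matrices, the perturbed pencil and the enclosure\<close>

lemma linear_operator_on_sum:
  assumes "linear_operator_on D A" "\<And>i. i \<in> I \<Longrightarrow> x i \<in> D"
  shows "A (\<Sum>i\<in>I. c i *\<^sub>C x i) = (\<Sum>i\<in>I. c i *\<^sub>C A (x i))"
proof -
  have D: "complex_vector.subspace D"
    and add: "\<And>x y. x \<in> D \<Longrightarrow> y \<in> D \<Longrightarrow> A (x + y) = A x + A y"
    and scale: "\<And>c x. x \<in> D \<Longrightarrow> A (c *\<^sub>C x) = c *\<^sub>C A x"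
    using assms(1) by (auto simp: linear_operator_on_def)
  \<comment> \<open>This settles the empty sum and also the sum over an infinite index set, which is
    0 by convention.\<close>
  have zero: "A 0 = 0"
    using scale[OF complex_vector.subspace_0[OF D], of 0] by simp
  show ?thesis
    using assms(2)
  proof (induction I rule: infinite_finite_induct)
    case (insert i I)
    have "(\<Sum>i\<in>I. c i *\<^sub>C x i) \<in> D"
      using insert.prems by (intro complex_vector.subspace_sum[OF D] complex_vector.subspace_scale[OF D]) auto
    then show ?case
      using insert complex_vector.subspace_scale[OF D] by (simp add: add scale)
  qed (simp_all add: zero)
qed

lemma norm_vector_smult: "norm (c *s v) = cmod c * norm (v :: complex ^ 'n)"
  by (simp add: norm_vec_def norm_mult L2_set_right_distrib)

text \<open>The real inner product on complex vectors is the real part of the Hermitian one, which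
  conjugates the entries of its left argument v. The second slot of \<open>cinner\<close> is
  conjugate-linear, so conjugated coefficients in both sums reproduce the matrix form.\<close>

lemma inner_smult_Gram_matrix:
  fixes f g :: "'n::finite \<Rightarrow> 'a::complex_inner"
  shows "v \<bullet> (c *s ((\<chi> j k. cinner (f j) (g k)) *v v)) =
    Re (c * cinner (\<Sum>j\<in>UNIV. cnj (v $ j) *\<^sub>C f j) (\<Sum>k\<in>UNIV. cnj (v $ k) *\<^sub>C g k))"
proof -
  have "v \<bullet> (c *s ((\<chi> j k. cinner (f j) (g k)) *v v)) =
    Re (\<Sum>j\<in>UNIV. cnj (v $ j) * (c * (\<Sum>k\<in>UNIV. cinner (f j) (g k) * v $ k)))"
    by (simp add: inner_vec_def matrix_vector_mult_def inner_complex_def)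
  also have "(\<Sum>j\<in>UNIV. cnj (v $ j) * (c * (\<Sum>k\<in>UNIV. cinner (f j) (g k) * v $ k))) =
    c * cinner (\<Sum>j\<in>UNIV. cnj (v $ j) *\<^sub>C f j) (\<Sum>k\<in>UNIV. cnj (v $ k) *\<^sub>C g k)"
    by (simp add: cinner_sum_left cinner_sum_right cinner_scaleC_left cinner_scaleC_right
        sum_distrib_left mult_ac) (rule sum.swap)
  finally show ?thesis .
qed

theorem theorem3:
  fixes D L :: "'a::complex_hilbert set"
    and A :: "'a \<Rightarrow> 'a"
    and e :: "'n::finite \<Rightarrow> 'a"
    and \<beta> \<epsilon>0 \<epsilon>1 \<epsilon>2 \<delta> :: real
    and A0 A1 A2 B0 B1 B2 :: "complex ^ 'n ^ 'n"
    and \<zeta> :: complex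
  assumes infinite_dim: "\<not> (\<exists>S :: 'a set. finite S \<and> complex_vector.span S = UNIV)"
    and self_adjoint: "self_adjoint_operator D A"
    and L_subspace: "complex_vector.subspace L" "L \<subseteq> D"
    and L_dim: "complex_vector.dim L = CARD('n)"
    and basis: "inj e" "complex_vector.independent (range e)"
      "complex_vector.span (range e) = L"
    and norm_e: "\<And>j. norm (e j) = 1"
    and beta_pos: "\<beta> > 0"
    and beta_bound: "\<And>c :: 'n \<Rightarrow> complex.
      norm (\<Sum>j\<in>UNIV. c j *\<^sub>C e j) \<ge> \<beta> * sqrt (\<Sum>j\<in>UNIV. (cmod (c j))\<^sup>2)"
    and A0: "A0 = (\<chi> j k. cinner (A (e j)) (A (e k)))"
    and A1: "A1 = (\<chi> j k. cinner (A (e j)) (e k))"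
    and A2: "A2 = (\<chi> j k. cinner (e j) (e k))"
    and eps_nonneg: "\<epsilon>0 \<ge> 0" "\<epsilon>1 \<ge> 0" "\<epsilon>2 \<ge> 0"
    and approx0: "onorm (\<lambda>v. (A0 - B0) *v v) \<le> \<epsilon>0"
    and approx1: "onorm (\<lambda>v. (A1 - B1) *v v) \<le> \<epsilon>1"
    and approx2: "onorm (\<lambda>v. (A2 - B2) *v v) \<le> \<epsilon>2"
    and singular:
      "\<not> invertible ((\<chi> j k. B0 $ j $ k - 2 * \<zeta> * B1 $ j $ k + \<zeta>\<^sup>2 * B2 $ j $ k) :: complex ^ 'n ^ 'n)"
    and delta: "\<delta> = sqrt (\<bar>Im \<zeta>\<bar>\<^sup>2 +
      ((cmod \<zeta>)\<^sup>2 * \<epsilon>2 + 2 * cmod \<zeta> * \<epsilon>1 + \<epsilon>0) / \<beta>\<^sup>2)"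
  shows "spectrum D A \<inter> complex_of_real ` {Re \<zeta> - \<delta> .. Re \<zeta> + \<delta>} \<noteq> {}"
proof -
  define \<eta> where "\<eta> = (cmod \<zeta>)\<^sup>2 * \<epsilon>2 + 2 * cmod \<zeta> * \<epsilon>1 + \<epsilon>0"
  define M :: "complex ^ 'n ^ 'n" where
    "M = (\<chi> j k. B0 $ j $ k - 2 * \<zeta> * B1 $ j $ k + \<zeta>\<^sup>2 * B2 $ j $ k)"
  have \<eta>: "\<eta> \<ge> 0" using eps_nonneg by (simp add: \<eta>_def)
  have lin: "linear_operator_on D A"
    using self_adjoint by (simp add: self_adjoint_operator_def)
  have eD: "e j \<in> D" for j
    using basis(3) L_subspace(2) complex_vector.span_base[of "e j" "range e"] by auto
  obtain v where v: "v \<noteq> 0" "M *v v = 0"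
    using singular matrix_left_invertible_ker[of M] unfolding M_def[symmetric] invertible_left_inverse
    by blast
  have "M *v v = B0 *v v - (2 * \<zeta>) *s (B1 *v v) + \<zeta>\<^sup>2 *s (B2 *v v)"
    by (simp add: vec_eq_iff M_def matrix_vector_mult_def sum_distrib_left sum.distrib sum_subtractf
        algebra_simps)
  \<comment> \<open>The perturbed pencil annihilates v, so at v the exact pencil equals the pencil
    of the three errors.\<close>
  with v(2) have split:
    "A0 *v v - (2 * \<zeta>) *s (A1 *v v) + \<zeta>\<^sup>2 *s (A2 *v v) =
      (A0 - B0) *v v - (2 * \<zeta>) *s ((A1 - B1) *v v) + \<zeta>\<^sup>2 *s ((A2 - B2) *v v)"
    by (simp add: matrix_vector_mult_diff_rdistrib vector_ssub_ldistrib algebra_simps)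
  have onorm_bound: "norm (N *v v) \<le> \<epsilon> * norm v" if "onorm (\<lambda>v. N *v v) \<le> \<epsilon>"
    for N :: "complex ^ 'n ^ 'n" and \<epsilon>
    using onorm[OF matrix_vector_mul_bounded_linear, of N v] mult_right_mono[OF that, of "norm v"]
    by simp
  have "norm (A0 *v v - (2 * \<zeta>) *s (A1 *v v) + \<zeta>\<^sup>2 *s (A2 *v v)) \<le>
      norm ((A0 - B0) *v v) + 2 * cmod \<zeta> * norm ((A1 - B1) *v v) + (cmod \<zeta>)\<^sup>2 * norm ((A2 - B2) *v v)"
    unfolding split
    using norm_triangle_ineq[of "(A0 - B0) *v v - (2 * \<zeta>) *s ((A1 - B1) *v v)" "\<zeta>\<^sup>2 *s ((A2 - B2) *v v)"]
      norm_triangle_ineq4[of "(A0 - B0) *v v" "(2 * \<zeta>) *s ((A1 - B1) *v v)"]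
    by (simp add: norm_vector_smult norm_mult norm_power)
  also have "\<dots> \<le> \<epsilon>0 * norm v + 2 * cmod \<zeta> * (\<epsilon>1 * norm v) + (cmod \<zeta>)\<^sup>2 * (\<epsilon>2 * norm v)"
    by (intro add_mono mult_left_mono onorm_bound approx0 approx1 approx2) auto
  also have "\<dots> = \<eta> * norm v" by (simp add: \<eta>_def algebra_simps)
  finally have residual: "norm (A0 *v v - (2 * \<zeta>) *s (A1 *v v) + \<zeta>\<^sup>2 *s (A2 *v v)) \<le> \<eta> * norm v" .

  define u where "u = (\<Sum>j\<in>UNIV. cnj (v $ j) *\<^sub>C e j)"
  have uD: "u \<in> D"
    unfolding u_def using lin eD
    by (auto simp: linear_operator_on_def intro: complex_vector.subspace_sum complex_vector.subspace_scale)
  have Au: "A u = (\<Sum>j\<in>UNIV. cnj (v $ j) *\<^sub>C A (e j))"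
    unfolding u_def using eD by (intro linear_operator_on_sum[OF lin])
  \<comment> \<open>Conjugation keeps the moduli, so the lower bound for the basis applies to u. It
    yields both u \<noteq> 0 and, later, the factor 1/\<beta>^2.\<close>
  have "\<beta> * norm v \<le> norm u"
    using beta_bound[of "\<lambda>j. cnj (v $ j)"] by (simp add: u_def norm_vec_def L2_set_def)
  then have v_le: "norm v \<le> norm u / \<beta>" using beta_pos by (simp add: field_simps)
  then have u0: "u \<noteq> 0" using v(1) by auto
  have "cnj (cinner (A u) u) = cinner (A u) u"
    using self_adjoint_operator_symmetric[OF self_adjoint uD uD] cinner_commute[of u "A u"] by simp
  then have Im0: "Im (cinner (A u) u) = 0"
    by (metis Reals_cnj_iff complex_is_Real_iff)
  have "v \<bullet> (A0 *v v - (2 * \<zeta>) *s (A1 *v v) + \<zeta>\<^sup>2 *s (A2 *v v)) =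
      Re (cinner (A u) (A u)) - Re (2 * \<zeta> * cinner (A u) u) + Re (\<zeta>\<^sup>2 * cinner u u)"
    using inner_smult_Gram_matrix[of v 1 "\<lambda>j. A (e j)" "\<lambda>j. A (e j)"]
      inner_smult_Gram_matrix[of v "2 * \<zeta>" "\<lambda>j. A (e j)" e]
      inner_smult_Gram_matrix[of v "\<zeta>\<^sup>2" e e]
    unfolding Au[symmetric] u_def[symmetric] A0[symmetric] A1[symmetric] A2[symmetric]
    by (simp add: inner_diff_right inner_add_right)
  \<comment> \<open>Because \<open>cinner (A u) u\<close> is real, only Re \<zeta> survives in the
    middle term; with Re (\<zeta>^2) = (Re \<zeta>)^2 - (Im \<zeta>)^2 the square is
    completed.\<close>
  also have "\<dots> = (norm (A u - Re \<zeta> *\<^sub>R u))\<^sup>2 - (Im \<zeta>)\<^sup>2 * (norm u)\<^sup>2"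
    unfolding norm_diff_scaleR_square cinner_self
    by (simp add: Im0 power2_eq_square algebra_simps)
  \<comment> \<open>Cauchy-Schwarz in the coefficient space bounds the form by the norm of v times
    that of the residual.\<close>
  finally have "(norm (A u - Re \<zeta> *\<^sub>R u))\<^sup>2 - (Im \<zeta>)\<^sup>2 * (norm u)\<^sup>2 \<le> norm v * (\<eta> * norm v)"
    using norm_cauchy_schwarz[of v "A0 *v v - (2 * \<zeta>) *s (A1 *v v) + \<zeta>\<^sup>2 *s (A2 *v v)"]
      mult_left_mono[OF residual norm_ge_zero[of v]] by linarith
  also have "\<dots> \<le> \<eta> * (norm u / \<beta>)\<^sup>2"
    using mult_left_mono[OF power_mono[OF v_le norm_ge_zero, of 2] \<eta>]
    by (simp add: power2_eq_square mult_ac)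
  finally have sq: "(norm (A u - Re \<zeta> *\<^sub>R u))\<^sup>2 \<le> ((Im \<zeta>)\<^sup>2 + \<eta> / \<beta>\<^sup>2) * (norm u)\<^sup>2"
    by (simp add: algebra_simps power_divide)
  have "norm (A u - Re \<zeta> *\<^sub>R u) \<le> \<delta> * norm u"
    using real_le_rsqrt[OF sq] by (simp add: delta real_sqrt_mult \<eta>_def)
  then show ?thesis
    by (rule approximate_eigenvalue_near_spectrum[OF self_adjoint uD u0])
qed

end
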